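(* Let $m\geq 1$ be an integer, $n=2m$, $A\in\mathbb{R}^{m\times n}$ and $k=\sqrt{n}$. Then the optimal value of the semidefinite program $$\begin{array}{ll} \mbox{maximize} & \mathrm{Tr}(Z)\\ \mbox{subject to} & AXA^T=0,\ \|X\|_1\leq 1,\\ & \sum_{i=1}^n |Y_{ij}|\leq k t_j,\ |Y_{ij}|\leq t_j,\ \mathbf{1}^Tt\leq k,\ t\leq\mathbf{1},\quad i,j=1,\ldots,n,\\ & \sum_{i=1}^n |Z_{ij}|\leq k r_j,\ |Z_{ij}|\leq r_j,\ \mathbf{1}^Tr\leq 1,\quad i,j=1,\ldots,n,\\ & \left(\begin{array}{cc} X & Z^T\\ Z & Y\end{array}\right)\succeq 0, \end{array}$$ in the variables $X,Y$ (symmetric $n\times n$ real matrices), $Z\in\mathbb{R}^{n\times n}$ and $r,t\in\mathbb{R}^n$, is larger than $1/2$.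
   Context: For a matrix $X$, $\|X\|_1$ denotes the sum of the absolute values of its entries. $\mathbf{1}$ is the vector of all ones in $\mathbb{R}^n$, vector inequalities are componentwise, $\mathrm{Tr}$ is the trace, and $\succeq 0$ means positive semidefinite. *)

theory Defs
  imports "HOL-Analysis.Analysis"
begin

definition entry_norm1 :: "real^'n^'m \<Rightarrow> real" where
  "entry_norm1 M = (\<Sum>i\<in>UNIV. \<Sum>j\<in>UNIV. \<bar>M $ i $ j\<bar>)"

definition symmetric_matrix :: "real^'n^'n \<Rightarrow> bool" where
  "symmetric_matrix M \<longleftrightarrow> transpose M = M"

definition pos_semidef :: "real^'n^'n \<Rightarrow> bool" where
  "pos_semidef M \<longleftrightarrow> symmetric_matrix M \<and> (\<forall>x. 0 \<le> x \<bullet> (M *v x))"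

text \<open>Block matrix with rows \<open>(P, Q)\<close> and \<open>(R, S)\<close>, indexed by a disjoint sum type.\<close>

definition block_matrix ::
    "real^'n^'m \<Rightarrow> real^'q^'m \<Rightarrow> real^'n^'p \<Rightarrow> real^'q^'p \<Rightarrow> real^('n + 'q)^('m + 'p)" where
  "block_matrix P Q R S =
    (\<chi> a b. case a of
        Inl i \<Rightarrow> (case b of Inl j \<Rightarrow> P $ i $ j | Inr j \<Rightarrow> Q $ i $ j)
      | Inr i \<Rightarrow> (case b of Inl j \<Rightarrow> R $ i $ j | Inr j \<Rightarrow> S $ i $ j))"

text \<open>In \<open>real^'n\<close> the constant \<open>1\<close> is the all-ones vector and \<open>\<le>\<close> is componentwise.\<close>

definition sdp_feasible ::
    "real^'n^'m \<Rightarrow> real \<Rightarrow>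
     ((real^'n^'n) \<times> (real^'n^'n) \<times> (real^'n^'n) \<times> (real^'n) \<times> (real^'n)) set" where
  "sdp_feasible A k = {(X, Y, Z, r, t).
     symmetric_matrix X \<and> symmetric_matrix Y \<and>
     A ** X ** transpose A = 0 \<and> entry_norm1 X \<le> 1 \<and>
     (\<forall>j. (\<Sum>i\<in>UNIV. \<bar>Y $ i $ j\<bar>) \<le> k * t $ j) \<and>
     (\<forall>i j. \<bar>Y $ i $ j\<bar> \<le> t $ j) \<and> 1 \<bullet> t \<le> k \<and> t \<le> 1 \<and>
     (\<forall>j. (\<Sum>i\<in>UNIV. \<bar>Z $ i $ j\<bar>) \<le> k * r $ j) \<and>
     (\<forall>i j. \<bar>Z $ i $ j\<bar> \<le> r $ j) \<and> 1 \<bullet> r \<le> 1 \<and>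
     pos_semidef (block_matrix X (transpose Z) Z Y)}"

text \<open>The optimal value is taken in the extended reals, where every supremum exists.\<close>

definition sdp_value :: "real^'n^'m \<Rightarrow> real \<Rightarrow> ereal" where
  "sdp_value A k = (SUP (X, Y, Z, r, t) \<in> sdp_feasible A k. ereal (trace Z))"

end

theory Submission
  imports Defs
begin

text \<open>
  The null space of \<open>A\<close> has dimension at least \<open>n - m = m\<close>. Let \<open>Q\<close> be the matrix of the
  orthogonal projector onto an \<open>m\<close>-dimensional subspace of it. Then \<open>A Q = 0\<close> and \<open>Tr Q = m\<close>,
  and suitable multiples \<open>X = a Q\<close>, \<open>Z = c Q\<close>, \<open>Y = b Q\<close> are feasible.

  The norm constraints are met because projectors have flat columns: \<open>Q\<^sup>T Q = Q\<close> says that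
  column \<open>j\<close> has Euclidean norm \<open>q\<^sub>j = sqrt Q\<^sub>j\<^sub>j\<close> (lemma
  \<open>column_sumsq_gram_orthonormal\<close>). Hence its entries are at most \<open>q\<^sub>j\<close>, its \<open>\<ell>\<^sub>1\<close>-norm is
  at most \<open>k q\<^sub>j\<close> with \<open>k = sqrt n\<close> by Cauchy-Schwarz, and a second use of Cauchy-Schwarz gives
  \<open>\<Sum> q\<^sub>j \<le> k sqrt m = k\<^sup>2 / sqrt 2\<close>. With \<open>r = c q\<close> and \<open>t = b q\<close> the constraints on
  \<open>X\<close>, \<open>Z\<close>, \<open>Y\<close> reduce to upper bounds on \<open>a\<close>, \<open>c\<close>, \<open>b\<close>, met by
  \<open>a = sqrt 2 / k\<^sup>3\<close>, \<open>c = sqrt 2 / k\<^sup>2\<close>, \<open>b = sqrt 2 / k\<close>. These three values happen to satisfy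
  \<open>a b = c\<^sup>2\<close>, which is exactly what positivity of the block matrix needs (lemma
  \<open>pos_semidef_block_gram\<close>). The objective is \<open>c m = sqrt 2 / 2 > 1 / 2\<close>.
\<close>

section \<open>Gram matrices\<close>

text \<open>The sum of the rank-one matrices \<open>f\<^sub>v f\<^sub>v\<^sup>T\<close>. For an orthonormal set \<open>B\<close>, \<open>gram B id\<close>
  is the orthogonal projector onto the span of \<open>B\<close>.\<close>

definition gram :: "'i set \<Rightarrow> ('i \<Rightarrow> real^'n) \<Rightarrow> real^'n^'n" where
  "gram I f = (\<chi> i j. \<Sum>v\<in>I. f v $ i * f v $ j)"

lemma symmetric_gram: "symmetric_matrix (gram I f)"
  by (simp add: symmetric_matrix_def gram_def transpose_def vec_eq_iff mult.commute)

lemma gram_mult_vector: "gram I f *v x = (\<Sum>v\<in>I. (f v \<bullet> x) *\<^sub>R f v)"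
proof (simp add: vec_eq_iff, intro allI)
  fix i
  have "(gram I f *v x) $ i = (\<Sum>j\<in>UNIV. \<Sum>v\<in>I. f v $ i * f v $ j * x $ j)"
    by (simp add: gram_def matrix_vector_mult_def sum_distrib_right)
  also have "\<dots> = (\<Sum>v\<in>I. \<Sum>j\<in>UNIV. f v $ i * f v $ j * x $ j)"
    by (rule sum.swap)
  also have "\<dots> = (\<Sum>v\<in>I. (f v \<bullet> x) * f v $ i)"
    by (simp add: inner_vec_def sum_distrib_left sum_distrib_right mult_ac)
  finally show "(gram I f *v x) $ i = (\<Sum>v\<in>I. (f v \<bullet> x) * f v $ i)" .
qed

lemma pos_semidef_gram: "pos_semidef (gram I f)"
proof -
  have "x \<bullet> (gram I f *v x) = (\<Sum>v\<in>I. (f v \<bullet> x)\<^sup>2)" for x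
    by (simp add: gram_mult_vector inner_sum_right power2_eq_square inner_commute)
  then show ?thesis
    by (simp add: pos_semidef_def symmetric_gram sum_nonneg)
qed

text \<open>The block matrix is again a Gram matrix, of the stacked vectors \<open>(\<alpha> v, \<beta> v)\<close>: the
  diagonal coefficients may differ as long as the off-diagonal one is their geometric mean.\<close>

lemma pos_semidef_block_gram:
  fixes f :: "'i \<Rightarrow> real^'n"
  shows "pos_semidef (block_matrix (\<alpha>\<^sup>2 *\<^sub>R gram I f) ((\<alpha> * \<beta>) *\<^sub>R gram I f)
                                   ((\<alpha> * \<beta>) *\<^sub>R gram I f) (\<beta>\<^sup>2 *\<^sub>R gram I f))"
proof -
  define g :: "'i \<Rightarrow> real^('n + 'n)" where
    "g v = (\<chi> a. case a of Inl i \<Rightarrow> \<alpha> * f v $ i | Inr i \<Rightarrow> \<beta> * f v $ i)" for v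
  have "block_matrix (\<alpha>\<^sup>2 *\<^sub>R gram I f) ((\<alpha> * \<beta>) *\<^sub>R gram I f)
                     ((\<alpha> * \<beta>) *\<^sub>R gram I f) (\<beta>\<^sup>2 *\<^sub>R gram I f) = gram I g"
    by (simp add: vec_eq_iff block_matrix_def gram_def g_def sum_distrib_left
        power2_eq_square mult_ac split: sum.split)
  then show ?thesis
    by (simp add: pos_semidef_gram)
qed

section \<open>Orthogonal projectors onto subspaces of the null space\<close>

text \<open>The null space is the orthogonal complement of the row space, whose dimension is at most the
  number of rows; any \<open>k\<close> vectors of an orthonormal basis will do.\<close>

lemma obtain_orthonormal_in_null_space:
  fixes A :: "real^'n^'m"
  assumes "k + CARD('m) \<le> CARD('n)"
  obtains B where "finite B" "card B = k" "pairwise orthogonal B"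
    "\<And>v. v \<in> B \<Longrightarrow> norm v = 1" "\<And>v. v \<in> B \<Longrightarrow> A *v v = 0"
proof -
  define N where "N = {y \<in> UNIV. \<forall>x \<in> rows A. orthogonal x y}"
  have null: "A *v y = 0" if "y \<in> N" for y
    using that
    by (auto simp: N_def vec_eq_iff matrix_vector_mul_component row_def rows_def
        orthogonal_def vec_lambda_eta)
  have sub: "subspace N"
    by (auto simp: N_def subspace_def orthogonal_clauses)
  have "N = {y \<in> UNIV. \<forall>x \<in> span (rows A). orthogonal x y}"
    unfolding N_def
  proof (intro Collect_cong conj_cong refl iffI ballI)
    fix x y
    assume "\<forall>x\<in>rows A. orthogonal x y" "x \<in> span (rows A)"
    then show "orthogonal x y"
      using orthogonal_to_span[of x "rows A" y] by (simp add: orthogonal_commute)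
  qed (simp add: span_base)
  then have "dim N + dim (rows A) = CARD('n)"
    using dim_subspace_orthogonal_to_vectors[of "span (rows A)" UNIV] by simp
  moreover have "dim (rows A) \<le> CARD('m)"
    by (metis rank_bound min.bounded_iff row_rank_def)
  ultimately have k: "k \<le> dim N"
    using assms by linarith
  obtain C where C: "C \<subseteq> N" "pairwise orthogonal C" "\<And>x. x \<in> C \<Longrightarrow> norm x = 1"
      "card C = dim N"
    by (rule orthonormal_basis_subspace[OF sub]) blast
  obtain B where "B \<subseteq> C" "card B = k" "finite B"
    using k unfolding C(4)[symmetric] by (rule obtain_subset_with_card_n)
  then show thesis
    using C null by (intro that[of B]) (auto intro: pairwise_subset)
qed

lemma orthonormal_inner:
  assumes "pairwise orthogonal B" "\<And>v. v \<in> B \<Longrightarrow> norm v = 1" "v \<in> B" "w \<in> B"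
  shows "v \<bullet> w = (if v = w then 1 else 0)"
  using assms by (auto simp: pairwise_def orthogonal_def dot_square_norm)

lemma trace_gram_orthonormal:
  fixes B :: "(real^'n) set"
  assumes "\<And>v. v \<in> B \<Longrightarrow> norm v = 1"
  shows "trace (gram B id) = real (card B)"
proof -
  have "trace (gram B id) = (\<Sum>v\<in>B. v \<bullet> v)"
    unfolding trace_def gram_def inner_vec_def by (simp add: sum.swap[of _ _ B])
  then show ?thesis
    using assms by (simp add: dot_square_norm)
qed

text \<open>This is the diagonal of \<open>Q\<^sup>T Q = Q\<close>: column \<open>j\<close> is the projection \<open>c\<close> of the \<open>j\<close>-th
  unit vector, so \<open>c \<bullet> c\<close> is the \<open>j\<close>-th coordinate of \<open>c\<close>.\<close>

lemma column_sumsq_gram_orthonormal: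
  fixes B :: "(real^'n) set"
  assumes "pairwise orthogonal B" "\<And>v. v \<in> B \<Longrightarrow> norm v = 1" and fin: "finite B"
  shows "(\<Sum>i\<in>UNIV. (gram B id $ i $ j)\<^sup>2) = gram B id $ j $ j"
proof -
  define c where "c = (\<Sum>v\<in>B. v $ j *\<^sub>R v)"
  have c: "gram B id $ i $ j = c $ i" for i
    by (simp add: gram_def c_def mult.commute)
  have vc: "v \<bullet> c = v $ j" if "v \<in> B" for v
  proof -
    have "v \<bullet> c = (\<Sum>w\<in>B. w $ j * (v \<bullet> w))"
      by (simp add: c_def inner_sum_right)
    also have "\<dots> = (\<Sum>w\<in>B. if v = w then w $ j else 0)"
      using that by (intro sum.cong refl) (simp add: orthonormal_inner[OF assms(1,2)])
    also have "\<dots> = v $ j"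
      using fin that by simp
    finally show ?thesis .
  qed
  have "(\<Sum>i\<in>UNIV. (gram B id $ i $ j)\<^sup>2) = c \<bullet> c"
    by (simp add: c inner_vec_def power2_eq_square)
  also have "\<dots> = (\<Sum>v\<in>B. v $ j * (v \<bullet> c))"
    by (subst (1) c_def) (simp add: inner_sum_left)
  also have "\<dots> = (\<Sum>v\<in>B. v $ j * v $ j)"
    by (intro sum.cong refl) (simp add: vc)
  also have "\<dots> = gram B id $ j $ j"
    by (simp add: gram_def)
  finally show ?thesis .
qed

lemma sum_abs_le_sqrt_card:
  "(\<Sum>i\<in>I. \<bar>f i\<bar>) \<le> sqrt (real (card I)) * sqrt (\<Sum>i\<in>I. (f i)\<^sup>2)"
  using L2_set_mult_ineq[of "\<lambda>_. 1" f I] by (simp add: L2_set_def)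

lemma matrix_mult_gram_eq_0:
  assumes "\<And>v. v \<in> I \<Longrightarrow> A *v f v = 0"
  shows "A ** gram I f = 0"
proof -
  have "A ** gram I f *v x = 0" for x
    by (simp add: matrix_vector_mul_assoc[symmetric] gram_mult_vector
        matrix_vector_mult_scaleR matrix_vector_right_distrib linear_sum[OF matrix_vector_mul_linear]
        assms)
  then show ?thesis
    by (simp add: matrix_eq)
qed

section \<open>The feasible point\<close>

theorem mainTheorem2:
  fixes A :: "real^'n^'m" and m n :: nat and k :: real
  assumes "CARD('m) = m" and "CARD('n) = n"
    and "m \<ge> 1" and "n = 2 * m" and "k = sqrt (real n)"
  shows "sdp_value A k > ereal (1 / 2)"
proof -
  obtain B where B: "finite B" "card B = m" "pairwise orthogonal B"
      "\<And>v. v \<in> B \<Longrightarrow> norm v = 1" "\<And>v. v \<in> B \<Longrightarrow> A *v v = 0"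
    using obtain_orthonormal_in_null_space[of m A] assms by auto
  define Q where "Q = gram B id"
  define q where "q j = sqrt (Q $ j $ j)" for j
  have k2: "k\<^sup>2 = 2 * real m" and "k > 0"
    using assms by auto
  have sqrt2: "sqrt 2 \<le> k"
    using assms by simp
  have trQ: "(\<Sum>j\<in>UNIV. Q $ j $ j) = real m"
    using trace_gram_orthonormal[of B] B by (simp add: Q_def trace_def)
  have col: "(\<Sum>i\<in>UNIV. (Q $ i $ j)\<^sup>2) = Q $ j $ j" for j
    unfolding Q_def using B by (intro column_sumsq_gram_orthonormal)
  have diag: "0 \<le> Q $ j $ j" for j
    by (subst col[symmetric]) (simp add: sum_nonneg)
  have q0: "0 \<le> q j" for j
    by (simp add: q_def diag)
  have entry: "\<bar>Q $ i $ j\<bar> \<le> q j" for i j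
  proof -
    have "(Q $ i $ j)\<^sup>2 \<le> (\<Sum>i\<in>UNIV. (Q $ i $ j)\<^sup>2)"
      by (rule member_le_sum) auto
    then show ?thesis
      unfolding q_def by (simp add: col real_le_rsqrt)
  qed
  \<comment> \<open>The diagonal entry of column \<open>j\<close> is \<open>q j ^ 2\<close>, and it is bounded by \<open>q j\<close>.\<close>
  have q1: "q j \<le> 1" for j
  proof -
    have "q j * q j \<le> q j * 1"
      using entry[of j j] diag[of j] by (simp add: q_def)
    then show ?thesis
      using q0[of j] by (cases "q j = 0") (auto simp: mult_le_cancel_left)
  qed
  have col1: "(\<Sum>i\<in>UNIV. \<bar>Q $ i $ j\<bar>) \<le> k * q j" for j
    using sum_abs_le_sqrt_card[of "\<lambda>i. Q $ i $ j" UNIV] assms by (simp add: col q_def)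
  have "(\<Sum>j\<in>UNIV. q j) \<le> k * sqrt (\<Sum>j\<in>UNIV. (q j)\<^sup>2)"
    using sum_abs_le_sqrt_card[of q UNIV] assms q0 by simp
  also have "\<dots> = k * sqrt (real m)"
    by (simp add: q_def diag trQ)
  also have "\<dots> = k * (k / sqrt 2)"
    using assms by (simp add: real_sqrt_mult)
  finally have sumq: "sqrt 2 * (\<Sum>j\<in>UNIV. q j) \<le> k\<^sup>2"
    by (simp add: field_simps power2_eq_square)

  \<comment> \<open>A square root of \<open>b\<close>: the stacked vectors \<open>(\<delta> / k) v, \<delta> v\<close> produce the coefficients \<open>a\<close>, \<open>c\<close>, \<open>b\<close>.\<close>
  define \<delta> where "\<delta> = sqrt (sqrt 2 / k)"
  have \<delta>2: "\<delta>\<^sup>2 = sqrt 2 / k"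
    using \<open>k > 0\<close> by (simp add: \<delta>_def)
  define a b c where "a = (\<delta> / k)\<^sup>2" and "b = \<delta>\<^sup>2" and "c = \<delta> / k * \<delta>"
  have a: "a = sqrt 2 / k ^ 3" and b: "b = sqrt 2 / k" and c: "c = sqrt 2 / k\<^sup>2"
    using \<delta>2 \<open>k > 0\<close>
    by (simp_all add: a_def b_def c_def power_divide field_simps power2_eq_square power3_eq_cube)
  have pos: "0 \<le> a" "0 \<le> b" "0 \<le> c" "b \<le> 1"
    using \<open>k > 0\<close> sqrt2 by (simp_all add: a b c)
  have sumabs: "(\<Sum>i\<in>UNIV. \<bar>(d *\<^sub>R Q) $ i $ j\<bar>) \<le> k * (d * q j)" if "0 \<le> d" for d j
    using mult_left_mono[OF col1[of j] that] that
    by (simp add: abs_mult sum_distrib_left mult_ac)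
  have maxabs: "\<bar>(d *\<^sub>R Q) $ i $ j\<bar> \<le> d * q j" if "0 \<le> d" for d i j
    using mult_left_mono[OF entry[of i j] that] that by (simp add: abs_mult)
  have inner1: "1 \<bullet> (\<chi> j. d * q j) = d * (\<Sum>j\<in>UNIV. q j)" for d
    by (simp add: inner_vec_def sum_distrib_left)
  have sumb: "b * (\<Sum>j\<in>UNIV. q j) \<le> k" and sumc: "c * (\<Sum>j\<in>UNIV. q j) \<le> 1"
    using sumq \<open>k > 0\<close> by (simp_all add: b c field_simps power2_eq_square)
  have symQ: "transpose (d *\<^sub>R Q) = d *\<^sub>R Q" for d
    using symmetric_gram[of B id]
    by (simp add: Q_def symmetric_matrix_def transpose_def vec_eq_iff)
  have "entry_norm1 (a *\<^sub>R Q) = (\<Sum>j\<in>UNIV. \<Sum>i\<in>UNIV. \<bar>(a *\<^sub>R Q) $ i $ j\<bar>)"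
    unfolding entry_norm1_def by (rule sum.swap)
  also have "\<dots> \<le> (\<Sum>j\<in>UNIV. k * (a * q j))"
    by (intro sum_mono sumabs pos)
  also have "\<dots> = c * (\<Sum>j\<in>UNIV. q j)"
    using \<open>k > 0\<close>
    by (simp add: a c sum_distrib_left power2_eq_square power3_eq_cube)
  finally have X1: "entry_norm1 (a *\<^sub>R Q) \<le> 1"
    using sumc by linarith
  have "A ** (a *\<^sub>R Q) = 0"
    using matrix_mult_gram_eq_0[of B A id] B by (simp add: Q_def matrix_scalar_ac scalar_matrix_assoc[symmetric])
  then have AXA: "A ** (a *\<^sub>R Q) ** transpose A = 0"
    by simp
  have psd: "pos_semidef (block_matrix (a *\<^sub>R Q) (c *\<^sub>R Q) (c *\<^sub>R Q) (b *\<^sub>R Q))"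
    unfolding a_def b_def c_def Q_def by (rule pos_semidef_block_gram)
  have t1: "(\<chi> j. b * q j) \<le> 1"
    using pos q0 q1 by (simp add: less_eq_vec_def mult_le_one)
  have "(a *\<^sub>R Q, b *\<^sub>R Q, c *\<^sub>R Q, (\<chi> j. c * q j), (\<chi> j. b * q j)) \<in> sdp_feasible A k"
    unfolding sdp_feasible_def mem_Collect_eq prod.case inner1 symQ symmetric_matrix_def
    using X1 AXA psd t1 sumb sumc sumabs maxabs pos by (auto simp del: vector_scaleR_component)
  then have "ereal (trace (c *\<^sub>R Q)) \<le> sdp_value A k"
    unfolding sdp_value_def by (rule SUP_upper2) simp
  moreover have "trace (c *\<^sub>R Q) = sqrt 2 / 2"
  proof -
    have "trace (c *\<^sub>R Q) = c * real m"
      unfolding trQ[symmetric] by (simp add: trace_def sum_distrib_left)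
    then show ?thesis
      using k2 assms by (simp add: c)
  qed
  moreover have "ereal (1 / 2) < ereal (sqrt 2 / 2)"
    by simp
  ultimately show ?thesis
    by (metis order_less_le_trans)
qed

end
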